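(* Let $A$ be a finite nonempty alphabet, $G$ a countable group, $S \subset G$ a finite nonempty subset, and $\mathcal{T} \subset A^S$. Suppose $|\mathcal{T}| = |A|^{|S|-1}$ and, for every $s \in S$, $\{P|_{S \setminus \{s\}} : P \in \mathcal{T}\} = A^{S \setminus \{s\}}$. Let $X = \{x \in A^G : \forall g \in G,\ (gx)|_S \in \mathcal{T}\}$. If $G$ admits a translation-invariant $S^{-1}S$-midpointed convex geometry $\mathcal{C}$, then: (1) locally legal patterns of convex shape are globally legal: for every $C \in \mathcal{C}$, a pattern $P \in A^C$ satisfies $P = x|_C$ for some $x \in X$ if and only if $P$ is $\mathcal{T}$-legal (i.e. all translates of $S$ that fit in its domain contain a pattern in $\mathcal{T}$); (2) there is a translation-invariant Borel probability measure $\mu$ on $X$ such that for every $C \in \mathcal{C}$, the marginal $\mu|_C$ is the uniform distribution on $X|_C = \{x|_C : x \in X\}$.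
   Context: Action: $G$ acts on $A^G$ by $(gx)_h = x_{g^{-1}h}$; for $P \in A^C$, $C\subset G$, the pattern $gP \in A^{gC}$ is $(gP)_h = P_{g^{-1}h}$. A pattern $P \in A^C$ is $\mathcal{T}$-legal if for all $g \in G$ with $gS \subset C$ we have $(g^{-1}P)|_S \in \mathcal{T}$. The marginal $\mu|_C$ is the measure on $A^C$ with $\mu|_C(P) = \mu(\{x \in X : x|_C = P\})$. Convex geometry: Let $\mathrm{FinSet}(G)$ be the set of finite subsets of $G$. A family $\mathcal{C} \subset \mathrm{FinSet}(G)$ is a convex geometry if $\mathcal{C} = \{\tau(B) : B \in \mathrm{FinSet}(G)\}$ for a map $\tau : \mathrm{FinSet}(G) \to \mathrm{FinSet}(G)$ with $\tau(\emptyset) = \emptyset$, $B \subset \tau(B)$, $B \subset B' \implies \tau(B) \subset \tau(B')$, $\tau(\tau(B)) = \tau(B)$, and the anti-exchange axiom holds: if $C \in \mathcal{C}$, $C \cap \{y,z\} = \emptyset$, $y \neq z$ and $y \in \tau(C \cup \{z\})$, then $z \notin \tau(C \cup \{y\})$. It is translation-invariant if $C \in \mathcal{C}$ implies $gC \in \mathcal{C}$ for all $g \in G$. For $R \subset G$, it is $R$-midpointed if $g \in \tau(\{gh, gh^{-1}\})$ for all $g \in G$ and $h \in R$. Here $S^{-1}S = \{s^{-1}t : s,t \in S\}$. *)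

theory Defs
  imports "HOL-Algebra.Coset" "HOL-Probability.Probability_Measure"
begin

(* A pattern P in A^C is an extensional function P \<in> C \<rightarrow>\<^sub>E A, and A^G is carrier G \<rightarrow>\<^sub>E A. *)

(* The pattern gP in A^(gC), for P in A^C.  As g <# carrier G = carrier G, the case
   C = carrier G is the action of G on A^G. *)
definition translate ::
    "('g, 'm) monoid_scheme \<Rightarrow> 'g set \<Rightarrow> 'g \<Rightarrow> ('g \<Rightarrow> 'a) \<Rightarrow> 'g \<Rightarrow> 'a" where
  "translate G C g P = (\<lambda>h \<in> g <#\<^bsub>G\<^esub> C. P (inv\<^bsub>G\<^esub> g \<otimes>\<^bsub>G\<^esub> h))"

abbreviation shift :: "('g, 'm) monoid_scheme \<Rightarrow> 'g \<Rightarrow> ('g \<Rightarrow> 'a) \<Rightarrow> 'g \<Rightarrow> 'a" where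
  "shift G \<equiv> translate G (carrier G)"

definition subshift ::
    "('g, 'm) monoid_scheme \<Rightarrow> 'a set \<Rightarrow> 'g set \<Rightarrow> ('g \<Rightarrow> 'a) set \<Rightarrow> ('g \<Rightarrow> 'a) set" where
  "subshift G A S T =
     {x \<in> carrier G \<rightarrow>\<^sub>E A. \<forall>g \<in> carrier G. restrict (shift G g x) S \<in> T}"

definition legal ::
    "('g, 'm) monoid_scheme \<Rightarrow> 'g set \<Rightarrow> ('g \<Rightarrow> 'a) set \<Rightarrow> 'g set \<Rightarrow> ('g \<Rightarrow> 'a) \<Rightarrow> bool" where
  "legal G S T C P \<longleftrightarrow>
     (\<forall>g \<in> carrier G. g <#\<^bsub>G\<^esub> S \<subseteq> C \<longrightarrow>
        restrict (translate G C (inv\<^bsub>G\<^esub> g) P) S \<in> T)"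

definition fin_sets :: "('g, 'm) monoid_scheme \<Rightarrow> 'g set set" where
  "fin_sets G = {B. finite B \<and> B \<subseteq> carrier G}"

(* The map \<tau> is kept as a parameter because midpointedness refers to it; it is determined on
   fin_sets G by \<C>, \<tau> B being the least member of \<C> that contains B. *)
definition convex_geometry ::
    "('g, 'm) monoid_scheme \<Rightarrow> ('g set \<Rightarrow> 'g set) \<Rightarrow> 'g set set \<Rightarrow> bool" where
  "convex_geometry G \<tau> \<C> \<longleftrightarrow>
     \<tau> \<in> fin_sets G \<rightarrow> fin_sets G \<and>
     \<C> = \<tau> ` fin_sets G \<and>
     \<tau> {} = {} \<and>
     (\<forall>B \<in> fin_sets G. B \<subseteq> \<tau> B) \<and>
     (\<forall>B \<in> fin_sets G. \<forall>B' \<in> fin_sets G. B \<subseteq> B' \<longrightarrow> \<tau> B \<subseteq> \<tau> B') \<and>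
     (\<forall>B \<in> fin_sets G. \<tau> (\<tau> B) = \<tau> B) \<and>
     (\<forall>C \<in> \<C>. \<forall>y \<in> carrier G. \<forall>z \<in> carrier G.
        C \<inter> {y, z} = {} \<longrightarrow> y \<noteq> z \<longrightarrow> y \<in> \<tau> (C \<union> {z}) \<longrightarrow> z \<notin> \<tau> (C \<union> {y}))"

definition translation_invariant_family ::
    "('g, 'm) monoid_scheme \<Rightarrow> 'g set set \<Rightarrow> bool" where
  "translation_invariant_family G \<C> \<longleftrightarrow>
     (\<forall>C \<in> \<C>. \<forall>g \<in> carrier G. g <#\<^bsub>G\<^esub> C \<in> \<C>)"

definition midpointed ::
    "('g, 'm) monoid_scheme \<Rightarrow> ('g set \<Rightarrow> 'g set) \<Rightarrow> 'g set \<Rightarrow> bool" where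
  "midpointed G \<tau> R \<longleftrightarrow>
     (\<forall>g \<in> carrier G. \<forall>h \<in> R. g \<in> \<tau> {g \<otimes>\<^bsub>G\<^esub> h, g \<otimes>\<^bsub>G\<^esub> inv\<^bsub>G\<^esub> h})"

definition borel_of :: "'x topology \<Rightarrow> 'x measure" where
  "borel_of U = sigma (topspace U) {V. openin U V}"

definition config_topology ::
    "('g, 'm) monoid_scheme \<Rightarrow> 'a set \<Rightarrow> ('g \<Rightarrow> 'a) topology" where
  "config_topology G A = product_topology (\<lambda>_. discrete_topology A) (carrier G)"

definition borel_prob_on :: "'x topology \<Rightarrow> 'x set \<Rightarrow> 'x measure \<Rightarrow> bool" where
  "borel_prob_on U X \<mu> \<longleftrightarrow>
     prob_space \<mu> \<and> space \<mu> = X \<and> sets \<mu> = sets (borel_of (subtopology U X))"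

(* Measurability of the shift is demanded explicitly because distr is meaningless without it. *)
definition translation_invariant_measure ::
    "('g, 'm) monoid_scheme \<Rightarrow> ('g \<Rightarrow> 'a) measure \<Rightarrow> bool" where
  "translation_invariant_measure G \<mu> \<longleftrightarrow>
     (\<forall>g \<in> carrier G. shift G g \<in> measurable \<mu> \<mu> \<and> distr \<mu> \<mu> (shift G g) = \<mu>)"

definition marginal ::
    "'a set \<Rightarrow> ('g \<Rightarrow> 'a) measure \<Rightarrow> 'g set \<Rightarrow> ('g \<Rightarrow> 'a) measure" where
  "marginal A \<mu> C =
     point_measure (C \<rightarrow>\<^sub>E A) (\<lambda>P. emeasure \<mu> {x \<in> space \<mu>. restrict x C = P})"

end

theory Submission
  imports Defs "HOL-Analysis.Infinite_Set_Sum" "HOL-Probability.Probability_Mass_Function"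
    "HOL-Probability.Discrete_Topology" "HOL-Probability.Projective_Limit"
begin

text \<open>
  The heart of the matter is that convexity makes the constraints on a pattern independent of
  each other. Enlarge a convex set \<open>C\<close> by one cell \<open>z\<close> such that \<open>insert z C\<close> is again convex. If two
  different translates of \<open>S\<close> in \<open>insert z C\<close> both contained \<open>z\<close>, then one of them would contain
  \<open>z \<otimes> h\<close> and the other one \<open>z \<otimes> inv h\<close> for some \<open>h \<noteq> \<one>\<close> in \<open>S\<inverse>S\<close>; both cells lie in \<open>C\<close>, and
  the midpoint \<open>z\<close> of the two would be in \<open>C\<close> by convexity (\<open>unique_new_window\<close>). So the new cell is
  subject to at most one new constraint. Counting shows that dropping the cell \<open>s\<close> is a bijection
  from \<open>T\<close> to the patterns on \<open>S - {s}\<close>, so such a constraint determines the new symbol and can always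
  be met (\<open>unique_completion\<close>). Hence the number of legal extensions to \<open>insert z C\<close>, which is \<open>1\<close> or
  \<open>card A\<close>, is the same for all legal patterns on \<open>C\<close>. By anti-exchange, any two nested convex sets are
  joined by a chain of convex sets that grows by one cell at a time, so restriction of legal
  patterns from a convex set to a smaller one has fibres of constant positive size
  (\<open>constant_fibres\<close>).

  Constant fibres mean that restriction maps uniform measures to uniform measures. The uniform
  measures on legal patterns over convex sets therefore form a consistent family, and as every finite
  set has a finite convex hull, they determine a consistent family of marginals over all finite
  sets. Kolmogorov's extension theorem yields a random configuration with these marginals. Each
  translate of the constraint holds almost surely and there are countably many of them, so the
  configuration is almost surely in the subshift (\<open>ex_uniform_measure\<close>).

  This also gives the first claim: a legal pattern on a
  convex set has positive probability, so it occurs in some point of the subshift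
  (\<open>restrictions_eq_legal_patterns\<close>). Invariance holds because translation is a bijection
  of legal patterns and therefore preserves the values of the measure on cylinders over convex sets,
  which are stable under intersection and generate the Borel sets.
\<close>

(* Frees the symbol for left cosets. *)
no_notation subset_mset (infix \<open><#\<close> 50)

section \<open>Convex geometries\<close>

lemma convex_geometryD:
  assumes "convex_geometry G \<tau> \<C>"
  shows hull_convex: "finite B \<Longrightarrow> B \<subseteq> carrier G \<Longrightarrow> \<tau> B \<in> \<C>"
    and convex_finite: "C \<in> \<C> \<Longrightarrow> finite C"
    and convex_subset_carrier: "C \<in> \<C> \<Longrightarrow> C \<subseteq> carrier G"
    and subset_hull: "finite B \<Longrightarrow> B \<subseteq> carrier G \<Longrightarrow> B \<subseteq> \<tau> B"
    and hull_mono: "finite B' \<Longrightarrow> B' \<subseteq> carrier G \<Longrightarrow> B \<subseteq> B' \<Longrightarrow> \<tau> B \<subseteq> \<tau> B'"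
    and hull_of_convex: "C \<in> \<C> \<Longrightarrow> \<tau> C = C"
    and empty_convex: "{} \<in> \<C>"
proof -
  from assms have *: "\<tau> \<in> fin_sets G \<rightarrow> fin_sets G" "\<C> = \<tau> ` fin_sets G" "\<tau> {} = {}"
    "\<forall>B \<in> fin_sets G. B \<subseteq> \<tau> B" 
    "\<forall>B \<in> fin_sets G. \<forall>B' \<in> fin_sets G. B \<subseteq> B' \<longrightarrow> \<tau> B \<subseteq> \<tau> B'"
    "\<forall>B \<in> fin_sets G. \<tau> (\<tau> B) = \<tau> B"
    unfolding convex_geometry_def by - (elim conjE, assumption)+
  show "finite B \<Longrightarrow> B \<subseteq> carrier G \<Longrightarrow> \<tau> B \<in> \<C>" using *(2) by (auto simp: fin_sets_def)
  show "C \<in> \<C> \<Longrightarrow> finite C" "C \<in> \<C> \<Longrightarrow> C \<subseteq> carrier G"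
    using *(1,2) by (auto simp: fin_sets_def Pi_iff)
  show "finite B \<Longrightarrow> B \<subseteq> carrier G \<Longrightarrow> B \<subseteq> \<tau> B" using *(4) by (auto simp: fin_sets_def)
  show "finite B' \<Longrightarrow> B' \<subseteq> carrier G \<Longrightarrow> B \<subseteq> B' \<Longrightarrow> \<tau> B \<subseteq> \<tau> B'"
    using *(5) finite_subset[of B B'] unfolding fin_sets_def by blast
  show "C \<in> \<C> \<Longrightarrow> \<tau> C = C" using *(2,6) by auto
  show "{} \<in> \<C>" using *(2,3) by (force simp: fin_sets_def)
qed

text \<open>
  The witness \<open>z\<close> minimises the size of the hull of \<open>insert z C\<close>: if that hull contained a further
  cell \<open>y\<close>, then by anti-exchange the hull of \<open>insert y C\<close> would miss \<open>z\<close> and thus be strictly smaller.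
\<close>

lemma convex_one_point_extension:
  assumes cg: "convex_geometry G \<tau> \<C>" and C: "C \<in> \<C>" and D: "D \<in> \<C>" and "C \<subset> D"
  obtains z where "z \<in> D - C" "insert z C \<in> \<C>"
proof -
  note fin = convex_finite[OF cg] convex_subset_carrier[OF cg]
  have ins: "finite (insert z C)" "insert z C \<subseteq> carrier G" if "z \<in> D" for z
    using fin[OF C] fin[OF D] that by auto
  have "D - C \<noteq> {}" using \<open>C \<subset> D\<close> by blast
  then obtain z where z: "z \<in> D - C"
    and least: "\<And>y. y \<in> D - C \<Longrightarrow> card (\<tau> (insert z C)) \<le> card (\<tau> (insert y C))"
    using ex_has_least_nat[of "\<lambda>z. z \<in> D - C" _ "\<lambda>z. card (\<tau> (insert z C))"] by blast
  have sub: "\<tau> (insert z C) \<subseteq> D"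
    using hull_mono[OF cg fin[OF D], of "insert z C"] z \<open>C \<subset> D\<close> unfolding hull_of_convex[OF cg D]
    by blast
  have "y \<in> insert z C" if y: "y \<in> \<tau> (insert z C)" for y
  proof (rule ccontr)
    assume "y \<notin> insert z C"
    then have yz: "C \<inter> {y, z} = {}" "y \<noteq> z" "y \<in> D - C" using z y sub by auto
    have "\<forall>C \<in> \<C>. \<forall>y \<in> carrier G. \<forall>z \<in> carrier G.
        C \<inter> {y, z} = {} \<longrightarrow> y \<noteq> z \<longrightarrow> y \<in> \<tau> (C \<union> {z}) \<longrightarrow> z \<notin> \<tau> (C \<union> {y})"
      using cg unfolding convex_geometry_def by (elim conjE)
    then have "z \<notin> \<tau> (insert y C)" using C yz fin[OF D] z y by auto
    have "\<tau> (insert z C) \<in> \<C>" using z by (intro hull_convex[OF cg] ins) auto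
    then have hz: "finite (\<tau> (insert z C))" "\<tau> (insert z C) \<subseteq> carrier G"
      "\<tau> (\<tau> (insert z C)) = \<tau> (insert z C)"
      by (fact fin hull_of_convex[OF cg])+
    have "insert z C \<subseteq> \<tau> (insert z C)" using z by (intro subset_hull[OF cg] ins) auto
    then have sub': "insert y C \<subseteq> \<tau> (insert z C)" "z \<in> \<tau> (insert z C)" using y by auto
    have "\<tau> (insert y C) \<subseteq> \<tau> (insert z C)"
      using hull_mono[OF cg hz(1,2) sub'(1)] unfolding hz(3) .
    then have "\<tau> (insert y C) \<subset> \<tau> (insert z C)"
      using \<open>z \<notin> \<tau> (insert y C)\<close> sub'(2) by blast
    then have "card (\<tau> (insert y C)) < card (\<tau> (insert z C))"
      by (rule psubset_card_mono[OF hz(1)])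
    then show False using least[OF yz(3)] by linarith
  qed
  then have "\<tau> (insert z C) = insert z C" using subset_hull[OF cg ins, of z] z by blast
  moreover have "\<tau> (insert z C) \<in> \<C>" using z by (intro hull_convex[OF cg] ins) auto
  ultimately show thesis using that[OF z] by simp
qed

section \<open>Legal patterns\<close>

text \<open>
  ``tep'' stands for totally extremally permutive: in a pattern of \<open>T\<close>, every symbol is determined by the
  others, which may be arbitrary.
\<close>

locale convex_tep = group G for G :: "('g, 'm) monoid_scheme" (structure) +
  fixes A :: "'a set" and S :: "'g set" and T :: "('g \<Rightarrow> 'a) set"
    and \<tau> :: "'g set \<Rightarrow> 'g set" and \<C> :: "'g set set"
  assumes countable_G: "countable (carrier G)"
    and A: "finite A" "A \<noteq> {}"
    and S: "finite S" "S \<noteq> {}" "S \<subseteq> carrier G"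
    and T: "T \<subseteq> S \<rightarrow>\<^sub>E A"
    and card_T: "card T = card A ^ (card S - 1)"
    and T_onto: "\<And>s. s \<in> S \<Longrightarrow> (\<lambda>P. restrict P (S - {s})) ` T = (S - {s}) \<rightarrow>\<^sub>E A"
    and geom: "convex_geometry G \<tau> \<C>"
    and invar: "translation_invariant_family G \<C>"
    and midp: "midpointed G \<tau> (set_inv S <#> S)"
begin

definition legal_patterns :: "'g set \<Rightarrow> ('g \<Rightarrow> 'a) set" where
  "legal_patterns C = {P \<in> C \<rightarrow>\<^sub>E A. legal G S T C P}"

lemma l_cosetI: "s \<in> B \<Longrightarrow> g \<otimes> s \<in> g <# B"
  by (auto simp: l_coset_def)

lemma mem_translate_iff:
  assumes "g \<in> carrier G" "C \<subseteq> carrier G" "h \<in> carrier G"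
  shows "h \<in> g <# C \<longleftrightarrow> inv g \<otimes> h \<in> C"
proof
  assume "h \<in> g <# C"
  then obtain c where c: "c \<in> C" "h = g \<otimes> c" by (auto simp: l_coset_def)
  then have "inv g \<otimes> h = c" using assms by (metis inv_solve_left subsetD)
  then show "inv g \<otimes> h \<in> C" using c by simp
next
  assume "inv g \<otimes> h \<in> C"
  then have "g \<otimes> (inv g \<otimes> h) \<in> g <# C" by (rule l_cosetI)
  moreover have "g \<otimes> (inv g \<otimes> h) = h" using assms by (metis inv_closed inv_inv inv_solve_left m_closed)
  ultimately show "h \<in> g <# C" by simp
qed

lemma window_translate:
  assumes "g \<in> carrier G" "C \<subseteq> carrier G" "g <# S \<subseteq> C"
  shows "restrict (translate G C (inv g) P) S = (\<lambda>s\<in>S. P (g \<otimes> s))"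
proof
  fix s
  have "s \<in> inv g <# C" if "s \<in> S"
    using assms that S l_cosetI[OF that, of g] by (subst mem_translate_iff) auto
  then show "restrict (translate G C (inv g) P) S s = (\<lambda>s\<in>S. P (g \<otimes> s)) s"
    using assms by (simp add: translate_def)
qed

lemma legal_patterns_iff:
  assumes "C \<subseteq> carrier G"
  shows "P \<in> legal_patterns C \<longleftrightarrow>
    P \<in> C \<rightarrow>\<^sub>E A \<and> (\<forall>g \<in> carrier G. g <# S \<subseteq> C \<longrightarrow> (\<lambda>s\<in>S. P (g \<otimes> s)) \<in> T)"
  using assms by (auto simp: legal_patterns_def legal_def window_translate)

lemma finite_l_coset: "finite C \<Longrightarrow> finite (g <# C)"
  by (auto simp: l_coset_def)

lemma translate_carrier: "g \<in> carrier G \<Longrightarrow> g <# carrier G = carrier G"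
  using mem_translate_iff[of g "carrier G"] l_coset_subset_G[of "carrier G" g] by auto

lemma shift_apply: "g \<in> carrier G \<Longrightarrow> shift G g x = (\<lambda>h\<in>carrier G. x (inv g \<otimes> h))"
  by (simp add: translate_def translate_carrier)

lemma subshift_eq_legal_patterns: "subshift G A S T = legal_patterns (carrier G)"
proof -
  have *: "restrict (shift G g x) S = (\<lambda>s\<in>S. x (inv g \<otimes> s))" if "g \<in> carrier G" for g and x :: "'g \<Rightarrow> 'a"
    using that S by (auto simp: shift_apply Int_absorb1)
  have "(\<forall>g \<in> carrier G. restrict (shift G g x) S \<in> T) \<longleftrightarrow> 
        (\<forall>g \<in> carrier G. (\<lambda>s\<in>S. x (g \<otimes> s)) \<in> T)" for x
    using * by (metis inv_closed inv_inv)
  then show ?thesis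
    using S by (auto simp: subshift_def legal_patterns_iff l_coset_subset_G)
qed

lemma restrict_legal_patterns:
  assumes P: "P \<in> legal_patterns D" and "C \<subseteq> D" "D \<subseteq> carrier G"
  shows "restrict P C \<in> legal_patterns C"
proof -
  have CG: "C \<subseteq> carrier G" using assms by blast
  have "(\<lambda>s\<in>S. restrict P C (g \<otimes> s)) = (\<lambda>s\<in>S. P (g \<otimes> s))" if "g <# S \<subseteq> C" for g
    using that l_cosetI[of _ S g] by (intro restrict_ext) auto
  then show ?thesis using P assms CG by (auto simp: legal_patterns_iff)
qed

lemma finite_legal_patterns: "finite C \<Longrightarrow> finite (legal_patterns C)"
  using A by (auto simp: legal_patterns_def intro: finite_PiE finite_subset)

lemma legal_patterns_empty: "legal_patterns {} = {\<lambda>_. undefined}"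
  using S by (auto simp: legal_patterns_iff l_coset_def)

section \<open>One new cell\<close>

text \<open>
  Restriction to \<open>S - {s}\<close> maps \<open>T\<close> onto a set of the same finite size, so it is also injective.
\<close>

lemma unique_completion:
  assumes s: "s \<in> S" and p: "p \<in> (S - {s}) \<rightarrow>\<^sub>E A"
  shows "\<exists>!a. a \<in> A \<and> p(s := a) \<in> T"
proof -
  let ?r = "\<lambda>P. restrict P (S - {s})"
  have finT: "finite T" using T A S by (meson finite_PiE finite_subset)
  have "card (?r ` T) = card T"
    using T_onto[OF s] s S by (simp add: card_T card_PiE card_Diff_singleton)
  then have inj: "inj_on ?r T" using finT by (simp add: eq_card_imp_inj_on)
  obtain P where P: "P \<in> T" "p = ?r P" using p T_onto[OF s] by blast
  have PE: "P \<in> S \<rightarrow>\<^sub>E A" using P T by blast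
  have *: "p(s := P s) = P"
    using P(2) PE s by (auto simp: fun_eq_iff PiE_iff extensional_def)
  show ?thesis
  proof (rule ex1I[of _ "P s"])
    show "P s \<in> A \<and> p(s := P s) \<in> T" using * PE s P by auto
    fix a assume a: "a \<in> A \<and> p(s := a) \<in> T"
    have "?r (p(s := a)) = p" using P(2) by (auto simp: fun_eq_iff)
    then have "p(s := a) = P" using inj a P by (auto simp: inj_on_def)
    then show "a = P s" by (metis fun_upd_same)
  qed
qed

text \<open>
  If \<open>z\<close> is the cell \<open>s\<close> of one translate
  and the cell \<open>s'\<close> of another one, then \<open>h = inv s \<otimes> s'\<close> places \<open>z\<close> halfway between a cell of the
  first and a cell of the second. Both of these cells are old, so convexity of \<open>C\<close> would
  make \<open>z\<close> old as well.
\<close>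

lemma unique_new_window:
  assumes C: "C \<in> \<C>" and z: "z \<in> carrier G" "z \<notin> C"
    and g: "g \<in> carrier G" "g <# S \<subseteq> insert z C" "z \<in> g <# S"
    and g': "g' \<in> carrier G" "g' <# S \<subseteq> insert z C" "z \<in> g' <# S"
  shows "g' = g"
proof (rule ccontr)
  assume "g' \<noteq> g"
  obtain s where s: "s \<in> S" "z = g \<otimes> s" using g by (auto simp: l_coset_def)
  obtain s' where s': "s' \<in> S" "z = g' \<otimes> s'" using g' by (auto simp: l_coset_def)
  have car: "s \<in> carrier G" "s' \<in> carrier G" using s s' S by auto
  define h where "h = inv s \<otimes> s'"
  have h: "h \<in> carrier G" "h \<in> set_inv S <#> S"
    using s s' car by (auto simp: h_def set_mult_def SET_INV_def)
  have "h \<noteq> \<one>"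
  proof
    assume "h = \<one>"
    then have "s' = s" using car by (metis h_def inv_closed inv_equality inv_inv)
    then show False using s s' \<open>g' \<noteq> g\<close> g g' car by (metis right_cancel)
  qed
  have zs: "z \<otimes> inv s = g" using s(2) g(1) car by (simp add: m_assoc)
  have zs': "z \<otimes> inv s' = g'" using s'(2) g'(1) car by (simp add: m_assoc)
  have "z \<otimes> h = z \<otimes> inv s \<otimes> s'" using z car by (simp add: h_def m_assoc)
  then have 1: "z \<otimes> h = g \<otimes> s'" unfolding zs .
  have "z \<otimes> inv h = z \<otimes> inv s' \<otimes> s" using z car by (simp add: h_def m_assoc inv_mult_group)
  then have 2: "z \<otimes> inv h = g' \<otimes> s" unfolding zs' .
  have "z \<otimes> h \<noteq> z" using \<open>h \<noteq> \<one>\<close> z h by simp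
  moreover have "z \<otimes> inv h \<noteq> z" using \<open>h \<noteq> \<one>\<close> z h by simp
  ultimately have "{z \<otimes> h, z \<otimes> inv h} \<subseteq> C"
    using 1 2 g(2) g'(2) l_cosetI[OF s'(1), of g] l_cosetI[OF s(1), of g'] by auto
  then have "\<tau> {z \<otimes> h, z \<otimes> inv h} \<subseteq> \<tau> C"
    using hull_mono[OF geom convex_finite[OF geom C] convex_subset_carrier[OF geom C]] by blast
  moreover have "z \<in> \<tau> {z \<otimes> h, z \<otimes> inv h}"
    using midp z h by (auto simp: midpointed_def)
  ultimately show False using z hull_of_convex[OF geom C] by blast
qed

text \<open>
  A pattern that is already legal on \<open>C\<close> only has to be checked on the translates through the new cell.
\<close>

lemma legal_patterns_extension_iff:
  assumes "C \<subseteq> carrier G" "z \<in> carrier G" "z \<notin> C" and P: "P \<in> legal_patterns C"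
  shows "P(z := a) \<in> legal_patterns (insert z C) \<longleftrightarrow> a \<in> A \<and>
    (\<forall>g \<in> carrier G. g <# S \<subseteq> insert z C \<longrightarrow> z \<in> g <# S \<longrightarrow>
       (\<lambda>s\<in>S. (P(z := a)) (g \<otimes> s)) \<in> T)"
proof -
  have PC: "P \<in> C \<rightarrow>\<^sub>E A" using P assms by (simp add: legal_patterns_iff)
  have "P(z := a) \<in> insert z C \<rightarrow>\<^sub>E A \<longleftrightarrow> a \<in> A"
    using PC \<open>z \<notin> C\<close> by (auto simp: PiE_iff extensional_def)
  moreover have "(\<lambda>s\<in>S. (P(z := a)) (g \<otimes> s)) \<in> T"
    if "g \<in> carrier G" "g <# S \<subseteq> insert z C" "z \<notin> g <# S" for g
  proof -
    have "(\<lambda>s\<in>S. (P(z := a)) (g \<otimes> s)) = (\<lambda>s\<in>S. P (g \<otimes> s))"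
      using that l_cosetI[of _ S g] by (auto simp: fun_eq_iff)
    moreover have "g <# S \<subseteq> C" using that by blast
    ultimately show ?thesis using P that assms by (simp add: legal_patterns_iff)
  qed
  ultimately show ?thesis using assms by (subst legal_patterns_iff) auto
qed

lemma one_cell_extensions:
  assumes C: "C \<in> \<C>" and z: "z \<in> carrier G" "z \<notin> C"
  shows "\<exists>k>0. \<forall>P \<in> legal_patterns C. card {Q \<in> legal_patterns (insert z C). restrict Q C = P} = k"
proof -
  have CG: "C \<subseteq> carrier G" using convex_subset_carrier[OF geom C] .
  have card_eq: "card {Q \<in> legal_patterns (insert z C). restrict Q C = P} = card {a. P(z := a) \<in> legal_patterns (insert z C)}"
    if P: "P \<in> legal_patterns C" for P
  proof -
    have PC: "P \<in> C \<rightarrow>\<^sub>E A" using P CG by (simp add: legal_patterns_iff)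
    have "bij_betw (\<lambda>a. P(z := a)) {a. P(z := a) \<in> legal_patterns (insert z C)} 
        {Q \<in> legal_patterns (insert z C). restrict Q C = P}"
    proof (rule bij_betwI[where g = "\<lambda>Q. Q z"])
      show "(\<lambda>a. P(z := a)) \<in> {a. P(z := a) \<in> legal_patterns (insert z C)} \<rightarrow> 
          {Q \<in> legal_patterns (insert z C). restrict Q C = P}"
        using PC z by (auto simp: fun_eq_iff PiE_iff extensional_def)
      have *: "P(z := Q z) = Q" if "Q \<in> legal_patterns (insert z C)" "restrict Q C = P" for Q
      proof -
        have "Q \<in> extensional (insert z C)" using that(1) by (auto simp: legal_patterns_def PiE_def)
        then show ?thesis
          unfolding that(2)[symmetric] using z by (auto simp: fun_eq_iff extensional_def)
      qed
      then show "(\<lambda>Q. Q z) \<in> {Q \<in> legal_patterns (insert z C). restrict Q C = P} \<rightarrow> 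
          {a. P(z := a) \<in> legal_patterns (insert z C)}" by auto
      show "P(z := Q z) = Q" if "Q \<in> {Q \<in> legal_patterns (insert z C). restrict Q C = P}" for Q
        using that * by blast
    qed auto
    then show ?thesis by (simp add: bij_betw_same_card)
  qed
  show ?thesis
  proof (cases "\<exists>g \<in> carrier G. g <# S \<subseteq> insert z C \<and> z \<in> g <# S")
    case False
    then have "{a. P(z := a) \<in> legal_patterns (insert z C)} = A" if "P \<in> legal_patterns C" for P
      using legal_patterns_extension_iff[OF CG z that] by auto
    then show ?thesis using card_eq A by (intro exI[of _ "card A"]) (auto simp: card_gt_0_iff)
  next
    case True
    then obtain g where g: "g \<in> carrier G" "g <# S \<subseteq> insert z C" "z \<in> g <# S" by blast
    obtain s where s: "s \<in> S" "z = g \<otimes> s" using g by (auto simp: l_coset_def)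
    have "card {a. P(z := a) \<in> legal_patterns (insert z C)} = 1" if P: "P \<in> legal_patterns C" for P
    proof -
      define p where "p = (\<lambda>t\<in>S - {s}. P (g \<otimes> t))"
      have PC: "P \<in> C \<rightarrow>\<^sub>E A" using P CG by (simp add: legal_patterns_iff)
      have other: "g \<otimes> t \<noteq> z" if "t \<in> S" "t \<noteq> s" for t
        using that s S g by (auto simp: subset_iff)
      have "p \<in> (S - {s}) \<rightarrow>\<^sub>E A"
        using PC g other l_cosetI[of _ S g] by (force simp: p_def)
      then obtain a where a: "\<And>b. b \<in> A \<and> p(s := b) \<in> T \<longleftrightarrow> b = a"
        using unique_completion[OF s(1)] by (metis (no_types, lifting))
      have window: "(\<lambda>t\<in>S. (P(z := b)) (g \<otimes> t)) = p(s := b)" for b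
        using s other by (auto simp: p_def fun_eq_iff)
      have "P(z := b) \<in> legal_patterns (insert z C) \<longleftrightarrow>
          b \<in> A \<and> (\<lambda>t\<in>S. (P(z := b)) (g \<otimes> t)) \<in> T" for b
        unfolding legal_patterns_extension_iff[OF CG z P]
        using unique_new_window[OF C z g] g by metis
      then have "P(z := b) \<in> legal_patterns (insert z C) \<longleftrightarrow> b = a" for b
        using a[of b] unfolding window by simp
      then show ?thesis by simp
    qed
    then show ?thesis using card_eq by (intro exI[of _ 1]) auto
  qed
qed

text \<open>
  Adding one cell multiplies the size of the fibre by the number of one-cell extensions. Since that
  number depends only on the shapes, so does the product along a chain from \<open>C\<close> to \<open>D\<close>.
\<close>

lemma constant_fibres:
  assumes "C \<in> \<C>" "D \<in> \<C>" "C \<subseteq> D"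
  shows "\<exists>k>0. \<forall>P \<in> legal_patterns C. card {Q \<in> legal_patterns D. restrict Q C = P} = k"
  using assms
proof (induction "card (D - C)" arbitrary: C)
  case 0
  then have "C = D" using convex_finite[OF geom \<open>D \<in> \<C>\<close>] by auto
  show ?case
  proof (intro exI[of _ 1] conjI ballI)
    fix P assume "P \<in> legal_patterns C"
    then have *: "{Q \<in> legal_patterns D. restrict Q C = P} = {P}"
      using \<open>C = D\<close> by (auto simp: legal_patterns_def PiE_iff extensional_restrict)
    show "card {Q \<in> legal_patterns D. restrict Q C = P} = 1" unfolding * by simp
  qed simp
next
  case (Suc n)
  have fin: "finite D" and DG: "D \<subseteq> carrier G" 
    using Suc convex_finite[OF geom] convex_subset_carrier[OF geom] by auto
  have "C \<subset> D" using Suc.hyps(2) Suc.prems by auto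
  then obtain z where z: "z \<in> D - C" and E: "insert z C \<in> \<C>"
    using convex_one_point_extension[OF geom] Suc.prems by metis
  have "card (D - insert z C) = n"
    using card_Diff_insert[of z D C] z Suc.hyps(2) by simp
  then obtain k where k: "k > 0" 
    "\<And>P. P \<in> legal_patterns (insert z C) \<Longrightarrow> card {Q \<in> legal_patterns D. restrict Q (insert z C) = P} = k"
    using Suc.hyps(1)[of "insert z C"] E Suc.prems z by blast
  obtain l where l: "l > 0"
    "\<And>P. P \<in> legal_patterns C \<Longrightarrow> card {Q \<in> legal_patterns (insert z C). restrict Q C = P} = l"
    using one_cell_extensions[of C z] Suc.prems z DG by blast
  have "card {Q \<in> legal_patterns D. restrict Q C = P} = l * k" if P: "P \<in> legal_patterns C" for P
  proof -
    let ?F = "{R \<in> legal_patterns (insert z C). restrict R C = P}"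
    have "finite (insert z C)" using fin Suc.prems(3) by (simp add: finite_subset)
    then have finF: "finite ?F" using finite_legal_patterns by simp
    have "{Q \<in> legal_patterns D. restrict Q C = P} = (\<Union>R\<in>?F. {Q \<in> legal_patterns D. restrict Q (insert z C) = R})"
    proof (intro equalityI subsetI)
      fix Q assume Q: "Q \<in> {Q \<in> legal_patterns D. restrict Q C = P}"
      then have "restrict Q (insert z C) \<in> legal_patterns (insert z C)"
        using restrict_legal_patterns[of Q D "insert z C"] z Suc.prems DG by auto
      moreover have "restrict (restrict Q (insert z C)) C = restrict Q C"
        by (auto simp: fun_eq_iff)
      ultimately show "Q \<in> (\<Union>R\<in>?F. {Q \<in> legal_patterns D. restrict Q (insert z C) = R})" using Q by auto
    next
      fix Q assume "Q \<in> (\<Union>R\<in>?F. {Q \<in> legal_patterns D. restrict Q (insert z C) = R})"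
      moreover have "restrict (restrict Q (insert z C)) C = restrict Q C"
        by (auto simp: fun_eq_iff)
      ultimately show "Q \<in> {Q \<in> legal_patterns D. restrict Q C = P}" by auto
    qed
    also have "card \<dots> = (\<Sum>R\<in>?F. card {Q \<in> legal_patterns D. restrict Q (insert z C) = R})"
      using finF finite_legal_patterns[OF fin] by (intro card_UN_disjoint) auto
    also have "\<dots> = l * k" using k(2) l(2)[OF P] by simp
    finally show ?thesis .
  qed
  then show ?case using k(1) l(1) by (intro exI[of _ "l * k"]) auto
qed

section \<open>Uniform measures on legal patterns\<close>

text \<open>
  The empty set is convex and carries exactly one (vacuously legal) pattern, and the fibre over it is
  everything.
\<close>

lemma legal_patterns_nonempty:
  assumes C: "C \<in> \<C>"
  shows "legal_patterns C \<noteq> {}"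
proof -
  obtain k where "k > 0" "\<forall>P \<in> legal_patterns {}. card {Q \<in> legal_patterns C. restrict Q {} = P} = k"
    using constant_fibres[OF empty_convex[OF geom] C] by auto
  then have "card {Q \<in> legal_patterns C. restrict Q {} = (\<lambda>_. undefined)} > 0"
    unfolding legal_patterns_empty by auto
  then have "{Q \<in> legal_patterns C. restrict Q {} = (\<lambda>_. undefined)} \<noteq> {}"
    unfolding card_gt_0_iff ..
  then show ?thesis by blast
qed

lemma finite_legal_patterns_convex: "C \<in> \<C> \<Longrightarrow> finite (legal_patterns C)"
  using finite_legal_patterns convex_finite[OF geom] by blast

text \<open>
  A uniform choice from a disjoint union of equally large fibres is a uniform choice of the
  fibre followed by a uniform choice within it.
\<close>

lemma restrict_uniform:
  assumes C: "C \<in> \<C>" and D: "D \<in> \<C>" and "C \<subseteq> D"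
  shows "map_pmf (\<lambda>Q. restrict Q C) (pmf_of_set (legal_patterns D)) = pmf_of_set (legal_patterns C)"
proof -
  let ?fib = "\<lambda>P. {Q \<in> legal_patterns D. restrict Q C = P}"
  obtain k where k: "k > 0" "\<And>P. P \<in> legal_patterns C \<Longrightarrow> card (?fib P) = k"
    using constant_fibres[OF assms] by auto
  have fib: "?fib P \<noteq> {} \<and> finite (?fib P)" if "P \<in> legal_patterns C" for P
    unfolding card_gt_0_iff[symmetric] k(2)[OF that] by (rule k(1))
  have "legal_patterns D = (\<Union>P \<in> legal_patterns C. ?fib P)"
    using restrict_legal_patterns[OF _ \<open>C \<subseteq> D\<close> convex_subset_carrier[OF geom D]] by blast
  then have "pmf_of_set (legal_patterns D) = pmf_of_set (\<Union>P \<in> legal_patterns C. ?fib P)" by simp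
  also have "\<dots> = bind_pmf (pmf_of_set (legal_patterns C)) (\<lambda>P. pmf_of_set (?fib P))"
  proof (rule pmf_of_set_UN)
    show "finite (\<Union>P \<in> legal_patterns C. ?fib P)" using finite_legal_patterns_convex[OF D] by (rule rev_finite_subset) auto
    show "disjoint_family_on ?fib (legal_patterns C)" unfolding disjoint_family_on_def by blast
  qed (use legal_patterns_nonempty[OF C] fib k in auto)
  finally have "map_pmf (\<lambda>Q. restrict Q C) (pmf_of_set (legal_patterns D)) =
      bind_pmf (pmf_of_set (legal_patterns C)) (\<lambda>P. map_pmf (\<lambda>Q. restrict Q C) (pmf_of_set (?fib P)))"
    by (simp add: map_bind_pmf)
  also have "\<dots> = bind_pmf (pmf_of_set (legal_patterns C)) return_pmf"
  proof (rule bind_pmf_cong[OF refl])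
    fix P assume "P \<in> set_pmf (pmf_of_set (legal_patterns C))"
    then have "P \<in> legal_patterns C" using legal_patterns_nonempty[OF C] finite_legal_patterns_convex[OF C] by simp
    note f = fib[OF this]
    have "map_pmf (\<lambda>Q. restrict Q C) (pmf_of_set (?fib P)) = map_pmf (\<lambda>_. P) (pmf_of_set (?fib P))"
    proof (rule map_pmf_cong[OF refl])
      fix Q assume "Q \<in> set_pmf (pmf_of_set (?fib P))"
      then show "restrict Q C = P"
        unfolding set_pmf_of_set[OF conjunct1[OF f] conjunct2[OF f]] by simp
    qed
    then show "map_pmf (\<lambda>Q. restrict Q C) (pmf_of_set (?fib P)) = return_pmf P" by simp
  qed
  finally show ?thesis by (simp add: bind_return_pmf')
qed

text \<open>
  The intended marginal over an arbitrary finite set: the hull \<open>\<tau> J\<close> may be replaced by any larger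
  convex set.
\<close>

definition law :: "'g set \<Rightarrow> ('g \<Rightarrow> 'a) pmf" where
  "law J = map_pmf (\<lambda>Q. restrict Q J) (pmf_of_set (legal_patterns (\<tau> J)))"

lemma restrict_law:
  assumes "J \<subseteq> K" and K: "finite K" "K \<subseteq> carrier G"
  shows "map_pmf (\<lambda>P. restrict P J) (law K) = law J"
proof -
  have J: "finite J" "J \<subseteq> carrier G" using assms finite_subset by auto
  have "restrict (restrict Q K) J = restrict (restrict Q (\<tau> J)) J" for Q :: "'g \<Rightarrow> 'a"
    using \<open>J \<subseteq> K\<close> subset_hull[OF geom J] by (intro ext) auto
  then have "map_pmf (\<lambda>P. restrict P J) (law K) =
      map_pmf (\<lambda>Q. restrict Q J) (map_pmf (\<lambda>Q. restrict Q (\<tau> J)) (pmf_of_set (legal_patterns (\<tau> K))))"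
    by (simp add: law_def pmf.map_comp comp_def del: restrict_restrict)
  also have "\<dots> = law J"
    unfolding law_def using hull_convex[OF geom] J K hull_mono[OF geom K \<open>J \<subseteq> K\<close>]
    by (subst restrict_uniform) auto
  finally show ?thesis .
qed

lemma set_law:
  assumes J: "finite J" "J \<subseteq> carrier G"
  shows "set_pmf (law J) \<subseteq> legal_patterns J"
proof
  fix P assume "P \<in> set_pmf (law J)"
  then obtain Q where "P = restrict Q J" "Q \<in> legal_patterns (\<tau> J)"
    using hull_convex[OF geom J] legal_patterns_nonempty finite_legal_patterns_convex by (auto simp: law_def)
  then show "P \<in> legal_patterns J"
    using restrict_legal_patterns[of Q "\<tau> J" J] subset_hull[OF geom J] hull_convex[OF geom J]
      convex_subset_carrier[OF geom] by auto
qed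

lemma law_convex:
  assumes C: "C \<in> \<C>"
  shows "law C = pmf_of_set (legal_patterns C)"
  unfolding law_def hull_of_convex[OF geom C] by (rule restrict_uniform[OF C C order_refl])

section \<open>The random configuration\<close>

text \<open>
  Kolmogorov's extension theorem needs a Polish state space, whereas \<open>A\<close> is a finite subset of a
  type without topology. The symbols are therefore coded by natural numbers with the discrete
  topology, and \<open>F\<close> decodes. Decoding is total with values in \<open>A\<close>, so \<open>F \<omega>\<close> is a configuration for every
  \<open>\<omega>\<close> and not just for almost every one.
\<close>

lemma ex_random_configuration:
  obtains M :: "('g \<Rightarrow> nat discrete) measure" and F :: "('g \<Rightarrow> nat discrete) \<Rightarrow> 'g \<Rightarrow> 'a"
  where "prob_space M"
    and "\<And>\<omega>. F \<omega> \<in> carrier G \<rightarrow>\<^sub>E A"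
    and "\<And>J B. finite J \<Longrightarrow> J \<subseteq> carrier G \<Longrightarrow>
           {\<omega> \<in> space M. restrict (F \<omega>) J \<in> B} \<in> sets M"
    and "\<And>J B. finite J \<Longrightarrow> J \<subseteq> carrier G \<Longrightarrow>
           emeasure M {\<omega> \<in> space M. restrict (F \<omega>) J \<in> B} = emeasure (law J) B"
proof -
  define enc where "enc a = discrete (to_nat_on A a)" for a
  define dec where "dec d = from_nat_into A (of_discrete d)" for d
  have dec_enc: "dec (enc a) = a" if "a \<in> A" for a
    using that A by (simp add: dec_def enc_def discrete_inverse countable_finite)
  have dec_in: "dec d \<in> A" for d using A by (simp add: dec_def from_nat_into)
  let ?E = "\<lambda>J Q. \<lambda>j\<in>J. enc (Q j)"
  let ?N = "\<lambda>J. PiM J (\<lambda>_. borel :: nat discrete measure)"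
  define P where "P J = distr (law J) (?N J) (?E J)" for J
  have P_meas: "?E J \<in> measurable (law K) (?N J)" for J K
    by (simp add: space_PiM)
  interpret polish_projective "carrier G" P
  proof (intro polish_projective.intro projective_family.intro)
    fix J H assume JH: "J \<subseteq> H" "finite H" "H \<subseteq> carrier G"
    have "distr (P H) (?N J) (\<lambda>f. restrict f J) = distr (law H) (?N J) ((\<lambda>f. restrict f J) \<circ> ?E H)"
      unfolding P_def by (rule distr_distr[OF measurable_restrict_subset[OF JH(1)] P_meas])
    also have "(\<lambda>f. restrict f J) \<circ> ?E H = ?E J \<circ> (\<lambda>Q. restrict Q J)"
      using JH(1) by (auto simp: fun_eq_iff)
    also have "distr (law H) (?N J) \<dots> =
        distr (distr (law H) (count_space UNIV) (\<lambda>Q. restrict Q J)) (?N J) (?E J)"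
      by (rule distr_distr[symmetric]) (auto simp: space_PiM)
    also have "\<dots> = P J"
      unfolding P_def restrict_law[OF JH, symmetric] map_pmf_rep_eq ..
    finally show "P J = distr (P H) (?N J) (\<lambda>f. restrict f J)" ..
  next
    fix J show "prob_space (P J)"
      unfolding P_def by (rule measure_pmf.prob_space_distr[OF P_meas])
  qed
  define F where "F \<omega> = (\<lambda>i\<in>carrier G. dec (\<omega> i))" for \<omega>
  have main: "{\<omega> \<in> space lim. restrict (F \<omega>) J \<in> B} \<in> sets lim \<and>
      emeasure lim {\<omega> \<in> space lim. restrict (F \<omega>) J \<in> B} = emeasure (law J) B"
    if J: "finite J" "J \<subseteq> carrier G" for J B
  proof -
    \<comment> \<open>the event in terms of the codes\<close>
    define B' where "B' = {w \<in> space (?N J). (\<lambda>j\<in>J. dec (w j)) \<in> B}"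
    have "sets (?N J) = sets (PiM J (\<lambda>_. count_space (UNIV :: nat discrete set)))"
      by (intro sets_PiM_cong) (auto simp: sets_borel_eq_count_space)
    also have "\<dots> = Pow (PiE J (\<lambda>_. UNIV))"
      using J by (subst count_space_PiM_finite) auto
    finally have B': "B' \<in> sets (?N J)" by (auto simp: B'_def space_PiM)
    have eq: "{\<omega> \<in> space lim. restrict (F \<omega>) J \<in> B} = emb (carrier G) J B'"
    proof -
      have "restrict (F \<omega>) J = (\<lambda>j\<in>J. dec (restrict \<omega> J j))" for \<omega>
        using J(2) by (auto simp: F_def fun_eq_iff)
      then show ?thesis
        by (auto simp: prod_emb_def B'_def space_PiM)
    qed
    have "emeasure lim (emb (carrier G) J B') = emeasure (P J) B'"
      using J B' by (intro emeasure_lim_emb) auto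
    also have "\<dots> = emeasure (law J) (?E J -` B' \<inter> space (law J))"
      unfolding P_def by (rule emeasure_distr[OF P_meas B'])
    also have "\<dots> = emeasure (law J) B"
    proof (rule emeasure_eq_AE)
      have "(\<lambda>j\<in>J. dec (?E J Q j)) = Q" if "Q \<in> set_pmf (law J)" for Q
      proof -
        have "Q \<in> J \<rightarrow>\<^sub>E A" using that set_law[OF J] by (auto simp: legal_patterns_def)
        then show ?thesis by (auto simp: fun_eq_iff dec_enc PiE_iff extensional_def)
      qed
      then show "AE Q in law J. (Q \<in> ?E J -` B' \<inter> space (law J)) = (Q \<in> B)"
        by (auto simp: AE_measure_pmf_iff B'_def space_PiM)
    qed auto
    finally show ?thesis using eq J B' by (simp add: measurable_prod_emb)
  qed
  have F_in: "F \<omega> \<in> carrier G \<rightarrow>\<^sub>E A" for \<omega>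
    using dec_in by (auto simp: F_def)
  show thesis
    by (rule that[OF P.prob_space_axioms F_in conjunct1[OF main] conjunct2[OF main]])
qed

abbreviation X :: "('g \<Rightarrow> 'a) set" where
  "X \<equiv> legal_patterns (carrier G)"

text \<open>
  The base \<open>B\<close> is a set of patterns rather than a single one: with single patterns, the
  intersection of two cylinders would in general only be a union of cylinders.
\<close>

definition cyl :: "'g set \<Rightarrow> ('g \<Rightarrow> 'a) set \<Rightarrow> ('g \<Rightarrow> 'a) set" where
  "cyl C B = {x \<in> X. restrict x C \<in> B}"

definition cylinders :: "('g \<Rightarrow> 'a) set set" where
  "cylinders = {cyl C B |C B. C \<in> \<C>}"

lemma cylI: "C \<in> \<C> \<Longrightarrow> cyl C B \<in> cylinders"
  by (auto simp: cylinders_def)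

lemma cylinders_subset: "cylinders \<subseteq> Pow X"
  by (auto simp: cylinders_def cyl_def)

lemma X_in_cylinders: "X \<in> cylinders"
  using cylI[OF empty_convex[OF geom], of UNIV] by (simp add: cyl_def)

text \<open>
  Membership in the subshift as countably many conditions, each on finitely many cells.
\<close>

lemma mem_X_iff:
  assumes x: "x \<in> carrier G \<rightarrow>\<^sub>E A"
  shows "x \<in> X \<longleftrightarrow> (\<forall>g \<in> carrier G. restrict x (g <# S) \<in> legal_patterns (g <# S))"
proof
  assume "x \<in> X"
  then show "\<forall>g \<in> carrier G. restrict x (g <# S) \<in> legal_patterns (g <# S)"
    using restrict_legal_patterns[OF _ l_coset_subset_G[OF S(3)]] by blast
next
  assume *: "\<forall>g \<in> carrier G. restrict x (g <# S) \<in> legal_patterns (g <# S)"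
  have "(\<lambda>s\<in>S. x (g \<otimes> s)) \<in> T" if g: "g \<in> carrier G" for g
  proof -
    have "(\<lambda>s\<in>S. restrict x (g <# S) (g \<otimes> s)) \<in> T"
      using * g l_coset_subset_G[OF S(3) g] by (auto simp: legal_patterns_iff)
    moreover have "(\<lambda>s\<in>S. restrict x (g <# S) (g \<otimes> s)) = (\<lambda>s\<in>S. x (g \<otimes> s))"
      by (intro restrict_ext) (simp add: l_cosetI)
    ultimately show ?thesis by simp
  qed
  then show "x \<in> X" using x by (simp add: legal_patterns_iff)
qed

text \<open>
  The random configuration lies in \<open>X\<close> almost surely; on the remaining null set it is
  replaced by a fixed point of \<open>X\<close>, so that its distribution is a measure on \<open>X\<close> itself.
\<close>

lemma ex_uniform_measure:
  obtains \<mu> where "prob_space \<mu>" "space \<mu> = X" "sets \<mu> = sigma_sets X cylinders"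
    "\<And>C B. C \<in> \<C> \<Longrightarrow> emeasure \<mu> (cyl C B) = emeasure (pmf_of_set (legal_patterns C)) B"
proof -
  obtain M :: "('g \<Rightarrow> nat discrete) measure" and F :: "('g \<Rightarrow> nat discrete) \<Rightarrow> 'g \<Rightarrow> 'a"
    where M: "prob_space M" and F: "\<And>\<omega>. F \<omega> \<in> carrier G \<rightarrow>\<^sub>E A"
    and F_sets: "\<And>J B. finite J \<Longrightarrow> J \<subseteq> carrier G \<Longrightarrow>
           {\<omega> \<in> space M. restrict (F \<omega>) J \<in> B} \<in> sets M"
    and F_law: "\<And>J B. finite J \<Longrightarrow> J \<subseteq> carrier G \<Longrightarrow>
           emeasure M {\<omega> \<in> space M. restrict (F \<omega>) J \<in> B} = emeasure (law J) B"
    using ex_random_configuration by blast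
  interpret M: prob_space M by (rule M)
  have gS: "finite (g <# S)" "g <# S \<subseteq> carrier G" if "g \<in> carrier G" for g
    using l_coset_subset_G[OF S(3) that] finite_l_coset[OF S(1)] by auto
  have "AE \<omega> in M. restrict (F \<omega>) (g <# S) \<in> legal_patterns (g <# S)" if "g \<in> carrier G" for g
  proof (rule M.AE_I_eq_1)
    have "emeasure (law (g <# S)) (legal_patterns (g <# S)) = 1"
      using set_law[OF gS[OF that]]
      by (intro measure_pmf.emeasure_eq_1_AE) (auto simp: AE_measure_pmf_iff)
    then show "emeasure M {\<omega> \<in> space M. restrict (F \<omega>) (g <# S) \<in> legal_patterns (g <# S)} = 1"
      using F_law[OF gS[OF that]] by simp
  qed (rule F_sets[OF gS[OF that]])
  then have "AE \<omega> in M. \<forall>g \<in> carrier G. restrict (F \<omega>) (g <# S) \<in> legal_patterns (g <# S)"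
    by (simp add: AE_ball_countable[OF countable_G])
  then have AE_X: "AE \<omega> in M. F \<omega> \<in> X"
    by (simp add: mem_X_iff[OF F])
  have X_sets: "{\<omega> \<in> space M. F \<omega> \<in> X} \<in> sets M"
  proof -
    have "{\<omega> \<in> space M. F \<omega> \<in> X} =
        space M \<inter> (\<Inter>g\<in>carrier G. {\<omega> \<in> space M. restrict (F \<omega>) (g <# S) \<in> legal_patterns (g <# S)})"
      by (auto simp: mem_X_iff[OF F])
    also have "\<dots> \<in> sets M"
      using F_sets[OF gS] countable_G by (intro sets.Int sets.top sets.countable_INT') auto
    finally show ?thesis .
  qed
  obtain x0 where x0: "x0 \<in> X"
    using AE_X M.AE_contr[of "\<lambda>\<omega>. F \<omega> \<in> X"] by (metis (mono_tags, lifting) AE_I2)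
  define H where "H \<omega> = (if F \<omega> \<in> X then F \<omega> else x0)" for \<omega>
  have fin: "finite C" "C \<subseteq> carrier G" if "C \<in> \<C>" for C
    using that convex_finite[OF geom] convex_subset_carrier[OF geom] by auto
  have H_vimage: "H -` cyl C B \<inter> space M \<in> sets M" if "C \<in> \<C>" for C B
  proof -
    have "H -` cyl C B \<inter> space M =
        ({\<omega> \<in> space M. F \<omega> \<in> X} \<inter> {\<omega> \<in> space M. restrict (F \<omega>) C \<in> B}) \<union>
        (if x0 \<in> cyl C B then space M - {\<omega> \<in> space M. F \<omega> \<in> X} else {})"
      using x0 by (auto simp: H_def cyl_def split: if_splits)
    then show ?thesis using X_sets F_sets[OF fin[OF that]] by auto
  qed
  have H_meas: "H \<in> measurable M (sigma X cylinders)"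
    using x0 H_vimage
    by (intro measurable_measure_of cylinders_subset) (auto simp: H_def cylinders_def)
  define \<mu> where "\<mu> = distr M (sigma X cylinders) H"
  have sets: "sets \<mu> = sigma_sets X cylinders" and space: "space \<mu> = X"
    using cylinders_subset by (simp_all add: \<mu>_def)
  have "emeasure \<mu> (cyl C B) = emeasure (pmf_of_set (legal_patterns C)) B" if C: "C \<in> \<C>" for C B
  proof -
    have "emeasure \<mu> (cyl C B) = emeasure M (H -` cyl C B \<inter> space M)"
      unfolding \<mu>_def using cylinders_subset cylI[OF C]
      by (intro emeasure_distr H_meas) auto
    also have "\<dots> = emeasure M {\<omega> \<in> space M. restrict (F \<omega>) C \<in> B}"
    proof (rule emeasure_eq_AE)
      show "AE \<omega> in M. (\<omega> \<in> H -` cyl C B \<inter> space M) =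
          (\<omega> \<in> {\<omega> \<in> space M. restrict (F \<omega>) C \<in> B})"
        using AE_X by eventually_elim (auto simp: H_def cyl_def)
    qed (use H_vimage[OF C] F_sets[OF fin[OF C]] in auto)
    also have "\<dots> = emeasure (pmf_of_set (legal_patterns C)) B"
      unfolding F_law[OF fin[OF C]] law_convex[OF C] ..
    finally show ?thesis .
  qed
  moreover have "prob_space \<mu>" unfolding \<mu>_def by (rule M.prob_space_distr[OF H_meas])
  ultimately show thesis using that sets space by blast
qed

text \<open>
  A legal pattern extends to a point of \<open>X\<close> because its cylinder has positive measure.
\<close>

lemma restrictions_eq_legal_patterns:
  assumes C: "C \<in> \<C>"
  shows "(\<lambda>x. restrict x C) ` X = legal_patterns C"
proof
  show "(\<lambda>x. restrict x C) ` X \<subseteq> legal_patterns C"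
    using restrict_legal_patterns convex_subset_carrier[OF geom C] by blast
  show "legal_patterns C \<subseteq> (\<lambda>x. restrict x C) ` X"
  proof
    fix P assume P: "P \<in> legal_patterns C"
    obtain \<mu> where \<mu>: "emeasure \<mu> (cyl C {P}) = emeasure (pmf_of_set (legal_patterns C)) {P}"
      using ex_uniform_measure C by metis
    have "emeasure (pmf_of_set (legal_patterns C)) {P} \<noteq> 0"
      using P finite_legal_patterns_convex[OF C] legal_patterns_nonempty[OF C]
      by (simp add: emeasure_pmf_single)
    then have "cyl C {P} \<noteq> {}" using \<mu> by (metis emeasure_empty)
    then show "P \<in> (\<lambda>x. restrict x C) ` X" by (auto simp: cyl_def)
  qed
qed

section \<open>Borel sets and uniqueness\<close>

lemma topspace_config: "topspace (config_topology G A) = carrier G \<rightarrow>\<^sub>E A"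
  by (simp add: config_topology_def)

lemma X_subset_topspace: "X \<subseteq> carrier G \<rightarrow>\<^sub>E A"
  by (auto simp: legal_patterns_def)

lemma openin_cyl:
  assumes "finite C" "C \<subseteq> carrier G"
  shows "openin (subtopology (config_topology G A) X) (cyl C B)"
proof -
  let ?W = "{x \<in> carrier G \<rightarrow>\<^sub>E A. restrict x C \<in> B}"
  have "openin (config_topology G A) ?W"
    unfolding config_topology_def openin_product_topology_alt
  proof (intro ballI exI conjI)
    fix x assume x: "x \<in> ?W"
    let ?U = "\<lambda>i. if i \<in> C then {x i} else A"
    have xA: "x i \<in> A" if "i \<in> carrier G" for i using x that by auto
    show "finite {i \<in> carrier G. ?U i \<noteq> topspace (discrete_topology A)}"
      by (rule finite_subset[OF _ assms(1)]) auto
    show "openin (discrete_topology A) (?U i)" if "i \<in> carrier G" for i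
      using xA[OF that] by auto
    show "x \<in> Pi\<^sub>E (carrier G) ?U" using x by (auto simp: PiE_iff)
    show "Pi\<^sub>E (carrier G) ?U \<subseteq> ?W"
    proof
      fix y assume y: "y \<in> Pi\<^sub>E (carrier G) ?U"
      have "y i = x i" if "i \<in> C" for i
        using PiE_mem[OF y, of i] assms(2) that by auto
      then have "restrict y C = restrict x C" by (intro restrict_ext)
      moreover have "y i \<in> A" if "i \<in> carrier G" for i
        using PiE_mem[OF y that] xA[OF that] by (auto split: if_splits)
      ultimately show "y \<in> ?W" using x y by (auto simp: PiE_iff)
    qed
  qed
  moreover have "cyl C B = ?W \<inter> X" using X_subset_topspace by (auto simp: cyl_def)
  ultimately show ?thesis unfolding openin_subtopology by blast
qed

lemma countable_convex: "countable \<C>"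
proof (rule countable_subset)
  show "\<C> \<subseteq> {B. finite B \<and> B \<subseteq> carrier G}"
    using convex_finite[OF geom] convex_subset_carrier[OF geom] by auto
  show "countable {B. finite B \<and> B \<subseteq> carrier G}"
    using countable_Collect_finite_subset[OF countable_G] by (simp add: conj_commute)
qed

lemma open_neighbourhood_cyl:
  assumes V: "openin (subtopology (config_topology G A) X) V" and x: "x \<in> V"
  shows "\<exists>C \<in> \<C>. cyl C {restrict x C} \<subseteq> V"
proof -
  obtain W where W: "openin (config_topology G A) W" "V = W \<inter> X"
    using V unfolding openin_subtopology by blast
  then obtain U where U: "finite {i \<in> carrier G. U i \<noteq> A}" "x \<in> Pi\<^sub>E (carrier G) U"
      "Pi\<^sub>E (carrier G) U \<subseteq> W"
    using x unfolding config_topology_def openin_product_topology_alt by auto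
  define J where "J = {i \<in> carrier G. U i \<noteq> A}"
  have J: "finite J" "J \<subseteq> carrier G" using U(1) by (auto simp: J_def)
  have "cyl (\<tau> J) {restrict x (\<tau> J)} \<subseteq> V"
  proof
    fix y assume "y \<in> cyl (\<tau> J) {restrict x (\<tau> J)}"
    then have y: "y \<in> X" "restrict y (\<tau> J) = restrict x (\<tau> J)" by (auto simp: cyl_def)
    have yPi: "y \<in> carrier G \<rightarrow>\<^sub>E A" using y(1) X_subset_topspace by blast
    have "y i \<in> U i" if i: "i \<in> carrier G" for i
    proof (cases "i \<in> J")
      case True
      then have "i \<in> \<tau> J" using subset_hull[OF geom J] by blast
      then have "y i = x i" using y(2) by (metis restrict_apply')
      then show ?thesis using PiE_mem[OF U(2) i] by simp
    next
      case False
      then show ?thesis using PiE_mem[OF yPi i] i by (auto simp: J_def)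
    qed
    then have "y \<in> Pi\<^sub>E (carrier G) U" using yPi by (auto simp: PiE_iff)
    then show "y \<in> V" using U(3) W(2) y(1) by blast
  qed
  then show ?thesis using hull_convex[OF geom J] by blast
qed

text \<open>
  Since \<open>G\<close> is countable and \<open>A\<close> is finite, there are only countably many cylinders with a single
  pattern as base, and every open set is the union of those that it contains.
\<close>

lemma sets_borel_of_X:
  "sets (borel_of (subtopology (config_topology G A) X)) = sigma_sets X cylinders"
proof -
  let ?\<O> = "{V. openin (subtopology (config_topology G A) X) V}"
  have top: "topspace (subtopology (config_topology G A) X) = X"
    using X_subset_topspace by (auto simp: topspace_config)
  then have sub: "?\<O> \<subseteq> Pow X" using openin_subset by fastforce
  have "sets (borel_of (subtopology (config_topology G A) X)) = sigma_sets X ?\<O>"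
    unfolding borel_of_def top using sub by simp
  also have "\<dots> = sigma_sets X cylinders"
  proof (rule sigma_sets_eqI)
    fix V assume "V \<in> ?\<O>"
    then have V: "openin (subtopology (config_topology G A) X) V" by simp
    let ?K = "(\<lambda>(C, P). cyl C {P}) ` (SIGMA C:\<C>. C \<rightarrow>\<^sub>E A)"
    have "finite (C \<rightarrow>\<^sub>E A)" if "C \<in> \<C>" for C
      using convex_finite[OF geom that] A(1) by (intro finite_PiE) auto
    then have "countable ?K"
      by (intro countable_image countable_SIGMA countable_convex countable_finite)
    then have K: "countable {Z \<in> ?K. Z \<subseteq> V}" by (rule countable_subset[rotated]) auto
    have "V = \<Union>{Z \<in> ?K. Z \<subseteq> V}"
    proof (intro equalityI subsetI)
      fix x assume x: "x \<in> V"
      then have xX: "x \<in> X" using V sub by auto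
      obtain C where C: "C \<in> \<C>" "cyl C {restrict x C} \<subseteq> V"
        using open_neighbourhood_cyl[OF V x] by blast
      have "restrict x C \<in> C \<rightarrow>\<^sub>E A"
        using xX X_subset_topspace convex_subset_carrier[OF geom C(1)] by auto
      then have "cyl C {restrict x C} \<in> {Z \<in> ?K. Z \<subseteq> V}" using C by force
      moreover have "x \<in> cyl C {restrict x C}" using xX by (simp add: cyl_def)
      ultimately show "x \<in> \<Union>{Z \<in> ?K. Z \<subseteq> V}" by (rule UnionI)
    next
      fix x assume "x \<in> \<Union>{Z \<in> ?K. Z \<subseteq> V}"
      then show "x \<in> V" by (elim UnionE CollectE conjE) (rule subsetD)
    qed
    moreover have "\<Union>{Z \<in> ?K. Z \<subseteq> V} \<in> sigma_sets X cylinders"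
      using K by (rule sigma_sets_UNION) (auto intro!: sigma_sets.Basic cylI)
    ultimately show "V \<in> sigma_sets X cylinders" by simp
  next
    fix Z assume "Z \<in> cylinders"
    then show "Z \<in> sigma_sets X ?\<O>"
      using openin_cyl convex_finite[OF geom] convex_subset_carrier[OF geom]
      by (auto simp: cylinders_def intro!: sigma_sets.Basic)
  qed
  finally show ?thesis .
qed

text \<open>
  Two cylinders over \<open>C\<close> and \<open>D\<close> are both cylinders over the hull of \<open>C \<union> D\<close>.
\<close>

lemma Int_stable_cylinders: "Int_stable cylinders"
proof (rule Int_stableI)
  fix Y Z assume "Y \<in> cylinders" "Z \<in> cylinders"
  then obtain C B D B' where C: "C \<in> \<C>" "Y = cyl C B" and D: "D \<in> \<C>" "Z = cyl D B'"
    by (auto simp: cylinders_def)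
  have CD: "finite (C \<union> D)" "C \<union> D \<subseteq> carrier G"
    using C D convex_finite[OF geom] convex_subset_carrier[OF geom] by auto
  let ?H = "\<tau> (C \<union> D)"
  have "restrict (restrict x ?H) C = restrict x C" "restrict (restrict x ?H) D = restrict x D"
    for x :: "'g \<Rightarrow> 'a"
    using subset_hull[OF geom CD] by (auto simp: fun_eq_iff)
  then have "Y \<inter> Z = cyl ?H {Q. restrict Q C \<in> B \<and> restrict Q D \<in> B'}"
    by (auto simp: C(2) D(2) cyl_def simp del: restrict_restrict)
  then show "Y \<inter> Z \<in> cylinders" using cylI[OF hull_convex[OF geom CD]] by simp
qed

lemma measure_eqI_cylinders:
  assumes "finite_measure M" "sets M = sigma_sets X cylinders" "sets N = sigma_sets X cylinders"
    and "\<And>C B. C \<in> \<C> \<Longrightarrow> emeasure M (cyl C B) = emeasure N (cyl C B)"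
  shows "M = N"
proof (rule measure_eqI_generator_eq[OF Int_stable_cylinders cylinders_subset _ assms(2,3)])
  show "emeasure M Z = emeasure N Z" if "Z \<in> cylinders" for Z
    using that assms(4) by (auto simp: cylinders_def)
  show "range (\<lambda>_ :: nat. X) \<subseteq> cylinders" using X_in_cylinders by auto
  show "emeasure M X \<noteq> \<infinity>"
    using finite_measure.emeasure_finite[OF assms(1)] by simp
qed simp

section \<open>Translation invariance\<close>

lemma translate_apply:
  "g \<in> carrier G \<Longrightarrow> C \<subseteq> carrier G \<Longrightarrow> s \<in> C \<Longrightarrow> translate G C g P (g \<otimes> s) = P s"
  by (simp add: translate_def l_cosetI m_assoc[symmetric] subset_iff)

lemma translate_translate_inv:
  assumes g: "g \<in> carrier G" and C: "C \<subseteq> carrier G" and P: "P \<in> extensional C"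
  shows "translate G (g <# C) (inv g) (translate G C g P) = P"
proof
  fix h
  have gC: "inv g <# (g <# C) = C"
    using g C by (simp add: lcos_m_assoc lcos_mult_one)
  show "translate G (g <# C) (inv g) (translate G C g P) h = P h"
  proof (cases "h \<in> C")
    case True
    then show ?thesis
      using g C translate_apply[OF g C True] by (simp add: translate_def[of _ "g <# C"] gC)
  next
    case False
    then show ?thesis using P by (simp add: translate_def[of _ "g <# C"] gC extensional_def)
  qed
qed

lemma translate_legal_patterns:
  assumes g: "g \<in> carrier G" and C: "C \<subseteq> carrier G" and P: "P \<in> legal_patterns C"
  shows "translate G C g P \<in> legal_patterns (g <# C)"
proof -
  have gC: "g <# C \<subseteq> carrier G" by (rule l_coset_subset_G[OF C g])
  have "translate G C g P h \<in> A" if "h \<in> g <# C" for h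
    using that P C translate_apply[OF g C, of _ P] by (auto simp: l_coset_def legal_patterns_def PiE_iff)
  then have "translate G C g P \<in> (g <# C) \<rightarrow>\<^sub>E A" by (auto simp: translate_def)
  moreover have "(\<lambda>s\<in>S. translate G C g P (f \<otimes> s)) \<in> T"
    if f: "f \<in> carrier G" and fS: "f <# S \<subseteq> g <# C" for f
  proof -
    have "inv g \<otimes> (f \<otimes> s) \<in> C" if "s \<in> S" for s
      using fS l_cosetI[OF that, of f] mem_translate_iff[OF g C, of "f \<otimes> s"] f that S by auto
    then have *: "inv g \<otimes> f \<otimes> s \<in> C" if "s \<in> S" for s
      using that f g S by (simp add: m_assoc subset_iff)
    then have "(inv g \<otimes> f) <# S \<subseteq> C" by (auto simp: l_coset_def)
    then have "(\<lambda>s\<in>S. P (inv g \<otimes> f \<otimes> s)) \<in> T"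
      using P C f g by (auto simp: legal_patterns_iff)
    moreover have "(\<lambda>s\<in>S. translate G C g P (f \<otimes> s)) = (\<lambda>s\<in>S. P (inv g \<otimes> f \<otimes> s))"
    proof (rule restrict_ext)
      fix s assume s: "s \<in> S"
      have "g \<otimes> (inv g \<otimes> f \<otimes> s) = f \<otimes> s"
        using s S f g by (simp add: m_assoc[symmetric] subset_iff)
      then show "translate G C g P (f \<otimes> s) = P (inv g \<otimes> f \<otimes> s)"
        using translate_apply[OF g C *[OF s]] by metis
    qed
    ultimately show ?thesis by simp
  qed
  ultimately show ?thesis using gC by (simp add: legal_patterns_iff)
qed

lemma bij_betw_translate_legal_patterns:
  assumes g: "g \<in> carrier G" and C: "C \<subseteq> carrier G"
  shows "bij_betw (translate G C g) (legal_patterns C) (legal_patterns (g <# C))"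
proof (rule bij_betwI[where g = "translate G (g <# C) (inv g)"])
  have gC: "g <# C \<subseteq> carrier G" and inv: "inv g <# (g <# C) = C"
    using g C by (simp_all add: lcos_m_assoc lcos_mult_one l_coset_subset_G)
  show "translate G C g \<in> legal_patterns C \<rightarrow> legal_patterns (g <# C)" using translate_legal_patterns[OF g C] by blast
  show "translate G (g <# C) (inv g) \<in> legal_patterns (g <# C) \<rightarrow> legal_patterns C"
    using translate_legal_patterns[OF inv_closed[OF g] gC] unfolding inv by blast
  show "translate G (g <# C) (inv g) (translate G C g P) = P" if "P \<in> legal_patterns C" for P
    using that by (intro translate_translate_inv[OF g C]) (auto simp: legal_patterns_def PiE_iff)
  show "translate G C g (translate G (g <# C) (inv g) P) = P" if "P \<in> legal_patterns (g <# C)" for P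
    using that translate_translate_inv[OF inv_closed[OF g] gC, of P] g
    by (auto simp: legal_patterns_def PiE_iff inv)
qed

lemma shift_X: "g \<in> carrier G \<Longrightarrow> x \<in> X \<Longrightarrow> shift G g x \<in> X"
  using translate_legal_patterns[of g "carrier G" x] by (simp add: translate_carrier)

lemma shift_vimage_cyl:
  assumes g: "g \<in> carrier G" and C: "C \<subseteq> carrier G"
  shows "shift G g -` cyl (g <# C) B \<inter> X = cyl C (translate G C g -` B)"
proof -
  have "restrict (shift G g x) (g <# C) = translate G C g (restrict x C)"
    for x :: "'g \<Rightarrow> 'a"
  proof
    fix h
    show "restrict (shift G g x) (g <# C) h = translate G C g (restrict x C) h"
      using l_coset_subset_G[OF C g] mem_translate_iff[OF g C, of h]
      by (auto simp: translate_def translate_carrier[OF g])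
  qed
  then show ?thesis using shift_X[OF g] by (auto simp: cyl_def)
qed

text \<open>
  The preimage of a cylinder over \<open>g <# D\<close> is the cylinder over \<open>D\<close> with translated base, and
  translation maps the uniform measure on legal patterns over \<open>D\<close> to the one over \<open>g <# D\<close>.
\<close>

lemma translation_invariant_uniform_measure:
  assumes prob: "prob_space \<mu>" and space: "space \<mu> = X" and sets: "sets \<mu> = sigma_sets X cylinders"
    and cyl: "\<And>C B. C \<in> \<C> \<Longrightarrow> emeasure \<mu> (cyl C B) = emeasure (pmf_of_set (legal_patterns C)) B"
  shows "translation_invariant_measure G \<mu>"
  unfolding translation_invariant_measure_def
proof (intro ballI conjI)
  fix g assume g: "g \<in> carrier G"
  interpret prob_space \<mu> by (rule prob)
  have preimage: "\<exists>D \<in> \<C>. g <# D = C" if "C \<in> \<C>" for C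
    using that invar g convex_subset_carrier[OF geom that]
    by (intro bexI[of _ "inv g <# C"])
       (auto simp: translation_invariant_family_def lcos_m_assoc lcos_mult_one)
  show meas: "shift G g \<in> measurable \<mu> \<mu>"
  proof (rule measurable_sigma_sets[OF sets cylinders_subset])
    show "shift G g \<in> space \<mu> \<rightarrow> X" using shift_X[OF g] space by auto
    fix Z assume "Z \<in> cylinders"
    then obtain C B where C: "C \<in> \<C>" "Z = cyl C B" by (auto simp: cylinders_def)
    obtain D where "D \<in> \<C>" "g <# D = C" using preimage[OF C(1)] by blast
    then have "D \<in> \<C>" "Z = cyl (g <# D) B" using C(2) by auto
    then show "shift G g -` Z \<inter> space \<mu> \<in> sets \<mu>"
      using shift_vimage_cyl[OF g convex_subset_carrier[OF geom]] cylI
      by (auto simp: space sets)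
  qed
  have "\<mu> = distr \<mu> \<mu> (shift G g)"
  proof (rule measure_eqI_cylinders)
    fix C B assume C: "C \<in> \<C>"
    then obtain D where D: "D \<in> \<C>" "g <# D = C" using preimage by blast
    have DG: "D \<subseteq> carrier G" using convex_subset_carrier[OF geom D(1)] .
    have "emeasure (distr \<mu> \<mu> (shift G g)) (cyl C B) = emeasure \<mu> (shift G g -` cyl C B \<inter> X)"
      using cylI[OF C] by (subst emeasure_distr[OF meas]) (auto simp: sets space)
    also have "\<dots> = emeasure (pmf_of_set (legal_patterns D)) (translate G D g -` B)"
      unfolding D(2)[symmetric] shift_vimage_cyl[OF g DG] by (rule cyl[OF D(1)])
    also have "\<dots> = emeasure (map_pmf (translate G D g) (pmf_of_set (legal_patterns D))) B"
      by simp
    also have "\<dots> = emeasure \<mu> (cyl C B)"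
      unfolding map_pmf_of_set_bij_betw[OF bij_betw_translate_legal_patterns[OF g DG] legal_patterns_nonempty[OF D(1)]
          finite_legal_patterns_convex[OF D(1)]] D(2) cyl[OF C] ..
    finally show "emeasure \<mu> (cyl C B) = emeasure (distr \<mu> \<mu> (shift G g)) (cyl C B)" ..
  qed (simp_all add: sets finite_measure_axioms)
  then show "distr \<mu> \<mu> (shift G g) = \<mu>" ..
qed

lemma marginal_uniform_measure:
  assumes C: "C \<in> \<C>" and space: "space \<mu> = X"
    and cyl: "\<And>B. emeasure \<mu> (cyl C B) = emeasure (pmf_of_set (legal_patterns C)) B"
  shows "marginal A \<mu> C = uniform_measure (count_space (C \<rightarrow>\<^sub>E A)) (legal_patterns C)"
proof (rule measure_eqI_finite)
  note fin = finite_legal_patterns_convex[OF C]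
  have sub: "legal_patterns C \<subseteq> C \<rightarrow>\<^sub>E A" by (auto simp: legal_patterns_def)
  have count: "emeasure (count_space (C \<rightarrow>\<^sub>E A)) B = of_nat (card B)" if "B \<subseteq> legal_patterns C" for B
    using that sub finite_subset[OF that fin] by (intro emeasure_count_space_finite) auto
  show finPi: "finite (C \<rightarrow>\<^sub>E A)"
    using convex_finite[OF geom C] A(1) by (intro finite_PiE) auto
  show "sets (marginal A \<mu> C) = Pow (C \<rightarrow>\<^sub>E A)"
    by (simp add: marginal_def sets_point_measure)
  show "sets (uniform_measure (count_space (C \<rightarrow>\<^sub>E A)) (legal_patterns C)) = Pow (C \<rightarrow>\<^sub>E A)" by simp
  fix P assume P: "P \<in> C \<rightarrow>\<^sub>E A"
  have "emeasure (marginal A \<mu> C) {P} = emeasure \<mu> (cyl C {P})"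
    using P finPi by (simp add: marginal_def emeasure_point_measure_finite cyl_def space)
  also have "\<dots> = of_nat (card (legal_patterns C \<inter> {P})) / of_nat (card (legal_patterns C))"
    unfolding cyl
    by (simp add: emeasure_pmf_of_set divide_ennreal ennreal_of_nat_eq_real_of_nat card_gt_0_iff
        legal_patterns_nonempty[OF C] fin)
  also have "\<dots> = emeasure (uniform_measure (count_space (C \<rightarrow>\<^sub>E A)) (legal_patterns C)) {P}"
    using P sub by (simp add: count)
  finally show "emeasure (marginal A \<mu> C) {P} =
      emeasure (uniform_measure (count_space (C \<rightarrow>\<^sub>E A)) (legal_patterns C)) {P}" .
qed

end

theorem theorem1:
  fixes G :: "('g, 'm) monoid_scheme"
    and A :: "'a set"
    and S :: "'g set"
    and T :: "('g \<Rightarrow> 'a) set"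
    and X :: "('g \<Rightarrow> 'a) set"
    and \<tau> :: "'g set \<Rightarrow> 'g set"
    and \<C> :: "'g set set"
  assumes "group G" and "countable (carrier G)"
    and "finite A" and "A \<noteq> {}"
    and "finite S" and "S \<noteq> {}" and "S \<subseteq> carrier G"
    and "T \<subseteq> S \<rightarrow>\<^sub>E A"
    and "card T = card A ^ (card S - 1)"
    and "\<forall>s \<in> S. (\<lambda>P. restrict P (S - {s})) ` T = (S - {s}) \<rightarrow>\<^sub>E A"
    and X_def: "X = subshift G A S T"
    and "convex_geometry G \<tau> \<C>"
    and "translation_invariant_family G \<C>"
    and "midpointed G \<tau> (set_inv\<^bsub>G\<^esub> S <#>\<^bsub>G\<^esub> S)"
  shows "(\<forall>C \<in> \<C>. \<forall>P \<in> C \<rightarrow>\<^sub>E A. (\<exists>x \<in> X. P = restrict x C) \<longleftrightarrow> legal G S T C P) \<and>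
    (\<exists>\<mu>. borel_prob_on (config_topology G A) X \<mu> \<and>
         translation_invariant_measure G \<mu> \<and>
         (\<forall>C \<in> \<C>. marginal A \<mu> C =
            uniform_measure (count_space (C \<rightarrow>\<^sub>E A)) ((\<lambda>x. restrict x C) ` X)))"
proof -
  interpret convex_tep G A S T \<tau> \<C>
    using assms by (intro convex_tep.intro convex_tep_axioms.intro) auto
  have X: "X = legal_patterns (carrier G)" unfolding X_def by (rule subshift_eq_legal_patterns)
  obtain \<mu> where \<mu>: "prob_space \<mu>" "space \<mu> = X" "sets \<mu> = sigma_sets X cylinders"
    "\<And>C B. C \<in> \<C> \<Longrightarrow> emeasure \<mu> (cyl C B) = emeasure (pmf_of_set (legal_patterns C)) B"
    using ex_uniform_measure unfolding X by blast
  have "borel_prob_on (config_topology G A) X \<mu>"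
    using \<mu> sets_borel_of_X by (simp add: borel_prob_on_def X)
  moreover have "translation_invariant_measure G \<mu>"
    using translation_invariant_uniform_measure \<mu> unfolding X by blast
  moreover have "marginal A \<mu> C =
      uniform_measure (count_space (C \<rightarrow>\<^sub>E A)) ((\<lambda>x. restrict x C) ` X)" if "C \<in> \<C>" for C
    unfolding X restrictions_eq_legal_patterns[OF that]
    using marginal_uniform_measure[OF that] \<mu> that unfolding X by blast
  moreover have "(\<exists>x \<in> X. P = restrict x C) \<longleftrightarrow> legal G S T C P"
    if "C \<in> \<C>" "P \<in> C \<rightarrow>\<^sub>E A" for C P
  proof -
    have "(\<exists>x \<in> X. P = restrict x C) \<longleftrightarrow> P \<in> legal_patterns C"
      unfolding X restrictions_eq_legal_patterns[OF that(1), symmetric] by (simp add: image_iff)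
    then show ?thesis using that(2) by (simp add: legal_patterns_def)
  qed
  ultimately show ?thesis by blast
qed

end
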